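(* Let $n$ be a positive integer, $X = [0,1]^n$, and let $p_S$ be any probability density function on $X$ (with respect to Lebesgue measure). Let $\mathcal V$ be the set of continuous surjective functions $X \to [0,1]$. For all $f \in \mathcal V$ and all $\alpha, \beta$ with $0 < \alpha, \beta < 1$, there exists a function $g \in \mathcal V$ that is both a C-proxy for $f$ (with parameters $\alpha,\beta$ and sampling density $p_S$) and catastrophic for $f$.
   Context: $X=[0,1]^n$ carries its Borel $\sigma$-algebra, $A=[0,1]$, $\mathcal M(X,A)$ is the set of Borel measurable functions $X \to A$, and $\Delta(X)$ is the set of Borel probability measures on $X$. C-proxy: $g \in \mathcal V$ is a C-proxy for $f \in \mathcal V$ when $\Pr_{x \sim p_S}[|g(x) - f(x)| > \alpha] < \beta$. Optimizer: a map $\Omega : \mathbb R_{\geq 0} \times \mathcal M(X,A) \times \Delta(X) \to \Delta(X)$, written $(k,g,p) \mapsto \Omega_k(g,p)$, such that for all $g \in \mathcal M(X,A)$ and $p \in \Delta(X)$: (1) $\Omega_0(g,p) = p$; (2) $j<k$ implies $\mathbb E_{x\sim\Omega_j(g,p)}[g(x)] \leq \mathbb E_{x\sim\Omega_k(g,p)}[g(x)]$; (3) for all $M < \sup_{y\in X} g(y)$, $\lim_{k\to\infty} \Pr_{x\sim\Omega_k(g,p)}[g(x) > M] = 1$; (4) $\lim_{k\to\infty} \mathbb E_{x\sim\Omega_k(g,p)}[g(x)] = \sup_{y\in X} g(y)$. $\eta$-catastrophic: for a real number $\eta$ with $\inf_{y\in X} f(y) \leq \eta < \sup_{y\in X} f(y)$,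 a value function $g$ is $\eta$-catastrophic for $f$ when for all initial priors $p \in \Delta(X)$ and all optimizers $\Omega$, $\limsup_{k\to\infty} \mathbb E_{x\sim\Omega_k(g,p)}[f(x)] \leq \eta$. It is catastrophic for $f$ when it is $\eta$-catastrophic for $f$ with $\eta = \inf_{y\in X} f(y)$. *)

theory Defs
  imports "HOL-Probability.Probability"
begin

abbreviation cube :: "(real ^ 'n) set" where
  "cube \<equiv> cbox 0 1"

abbreviation borel_cube :: "(real ^ 'n) measure" where
  "borel_cube \<equiv> restrict_space borel cube"

text \<open>
  Functions on the cube are represented by functions on the whole space that are
  \<^const>\<open>undefined\<close> off the cube, so that an optimizer sees only the values on the cube.
\<close>

definition measurable_functions :: "(real ^ 'n \<Rightarrow> real) set" where
  "measurable_functions =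
     measurable borel_cube (restrict_space borel {0..1}) \<inter> extensional cube"

definition value_functions :: "(real ^ 'n \<Rightarrow> real) set" where
  "value_functions =
     {f. continuous_on cube f \<and> f ` cube = {0..1} \<and> f \<in> extensional cube}"

definition prob_measures :: "(real ^ 'n) measure set" where
  "prob_measures = space (prob_algebra borel_cube)"

definition prob_density :: "(real ^ 'n \<Rightarrow> real) \<Rightarrow> bool" where
  "prob_density p \<longleftrightarrow>
     p \<in> borel_measurable borel_cube \<and>
     (\<forall>x\<in>cube. 0 \<le> p x) \<and>
     (\<integral>\<^sup>+x. ennreal (p x) \<partial>restrict_space lborel cube) = 1"

definition sampling_measure :: "(real ^ 'n \<Rightarrow> real) \<Rightarrow> (real ^ 'n) measure" where
  "sampling_measure p = density (restrict_space lborel cube) (\<lambda>x. ennreal (p x))"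

definition C_proxy ::
  "(real ^ 'n \<Rightarrow> real) \<Rightarrow> real \<Rightarrow> real \<Rightarrow> (real ^ 'n \<Rightarrow> real) \<Rightarrow> (real ^ 'n \<Rightarrow> real) \<Rightarrow> bool"
  where
  "C_proxy p \<alpha> \<beta> f g \<longleftrightarrow>
     f \<in> value_functions \<and> g \<in> value_functions \<and>
     measure (sampling_measure p) {x \<in> cube. \<bar>g x - f x\<bar> > \<alpha>} < \<beta>"

text \<open>
  The strength parameter ranges over the nonnegative reals; values of an optimizer at
  negative parameters, or at arguments outside the stated domains, are irrelevant.
\<close>

definition optimizer ::
  "(real \<Rightarrow> (real ^ 'n \<Rightarrow> real) \<Rightarrow> (real ^ 'n) measure \<Rightarrow> (real ^ 'n) measure) \<Rightarrow> bool" where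
  "optimizer \<Omega> \<longleftrightarrow>
     (\<forall>g \<in> measurable_functions. \<forall>p \<in> prob_measures.
        (\<forall>k\<ge>0. \<Omega> k g p \<in> prob_measures) \<and>
        \<Omega> 0 g p = p \<and>
        (\<forall>j k. 0 \<le> j \<longrightarrow> j < k \<longrightarrow> (\<integral>x. g x \<partial>\<Omega> j g p) \<le> (\<integral>x. g x \<partial>\<Omega> k g p)) \<and>
        (\<forall>M < (SUP y\<in>cube. g y).
           ((\<lambda>k. measure (\<Omega> k g p) {x \<in> cube. g x > M}) \<longlongrightarrow> 1) at_top) \<and>
        ((\<lambda>k. \<integral>x. g x \<partial>\<Omega> k g p) \<longlongrightarrow> (SUP y\<in>cube. g y)) at_top)"

definition eta_catastrophic ::
  "real \<Rightarrow> (real ^ 'n \<Rightarrow> real) \<Rightarrow> (real ^ 'n \<Rightarrow> real) \<Rightarrow> bool" where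
  "eta_catastrophic \<eta> f g \<longleftrightarrow>
     (INF y\<in>cube. f y) \<le> \<eta> \<and> \<eta> < (SUP y\<in>cube. f y) \<and>
     (\<forall>p \<in> prob_measures. \<forall>\<Omega>. optimizer \<Omega> \<longrightarrow>
        Limsup at_top (\<lambda>k. ereal (\<integral>x. f x \<partial>\<Omega> k g p)) \<le> ereal \<eta>)"

definition catastrophic :: "(real ^ 'n \<Rightarrow> real) \<Rightarrow> (real ^ 'n \<Rightarrow> real) \<Rightarrow> bool" where
  "catastrophic f g \<longleftrightarrow> eta_catastrophic (INF y\<in>cube. f y) f g"

end

theory Submission
  imports Defs
begin

text \<open>
  Pick \<open>z\<close> and \<open>w\<close> with \<open>f z = 0\<close> and \<open>f w = 1\<close>. Cutting \<open>f\<close> off at height \<open>1 - \<alpha>\<close> changes it by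
  at most \<open>\<alpha>\<close>. A tent of height 1 over a small ball at \<open>z\<close> then makes \<open>z\<close> the only maximum point,
  and pressing the function down to 0 at \<open>w\<close> keeps it surjective, because the tent may have
  destroyed the only zero of \<open>f\<close>. The two balls are small for the sampling measure because that
  measure has no atoms. Optimizing for \<open>g\<close> concentrates the mass where \<open>g\<close> is close to 1, and by
  compactness \<open>f\<close> is close to 0 there.
\<close>

lemma value_functions_subset_measurable_functions:
  "value_functions \<subseteq> (measurable_functions :: (real ^ 'n \<Rightarrow> real) set)"
proof
  fix g :: "real ^ 'n \<Rightarrow> real"
  assume g: "g \<in> value_functions"
  then have "g \<in> borel_measurable borel_cube"
    by (auto simp: value_functions_def intro: borel_measurable_continuous_on_restrict)
  with g show "g \<in> measurable_functions"
    by (auto simp: value_functions_def measurable_functions_def space_restrict_space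
        intro!: measurable_restrict_space2)
qed

lemma value_functions_bounds:
  assumes "f \<in> value_functions" "x \<in> cube"
  shows "0 \<le> f x" "f x \<le> 1"
  using assms by (auto simp: value_functions_def)

lemma value_functions_INF_SUP:
  fixes f :: "real ^ 'n \<Rightarrow> real"
  assumes "f \<in> value_functions"
  shows "(INF y\<in>cube. f y) = 0" "(SUP y\<in>cube. f y) = 1"
  using assms by (auto simp: value_functions_def)

text \<open>The set where \<open>f\<close> is at least \<epsilon> is compact, so \<open>g\<close>
  attains a maximum on it. That maximum is below 1, since \<open>g x = 1\<close> would force
  \<open>f x = 0\<close>, and it serves as \<open>M\<close>.\<close>

lemma value_functions_superlevel:
  fixes f g :: "real ^ 'n \<Rightarrow> real"
  assumes f: "f \<in> value_functions" and g: "g \<in> value_functions"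
    and zero: "\<And>x. x \<in> cube \<Longrightarrow> g x = 1 \<Longrightarrow> f x = 0"
    and "\<epsilon> > 0"
  obtains M where "M < 1" "\<And>x. x \<in> cube \<Longrightarrow> M < g x \<Longrightarrow> f x < \<epsilon>"
proof -
  let ?K = "cube \<inter> f -` {\<epsilon>..}"
  have cf: "continuous_on cube f" and cg: "continuous_on cube g"
    using f g by (auto simp: value_functions_def)
  have "closed ?K"
    by (intro continuous_closed_preimage cf closed_cbox closed_atLeast)
  then have K: "compact ?K"
    by (metis compact_Int_closed compact_cbox inf.left_idem)
  show ?thesis
  proof (cases "?K = {}")
    \<comment> \<open>Here \<open>f\<close> is below \<epsilon> on the whole cube, so any threshold
      below 1 will do.\<close>
    case True
    with that[of 0] show ?thesis by force
  next
    case False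
    then obtain x0 where x0: "x0 \<in> ?K" "\<And>x. x \<in> ?K \<Longrightarrow> g x \<le> g x0"
      using continuous_attains_sup[OF K] continuous_on_subset[OF cg] by (metis inf_le1)
    have "g x0 < 1"
      using x0(1) zero[of x0] value_functions_bounds(2)[OF g, of x0] \<open>\<epsilon> > 0\<close> by force
    moreover have "f x < \<epsilon>" if "x \<in> cube" "g x0 < g x" for x
      using x0(2)[of x] that by force
    ultimately show ?thesis using that by blast
  qed
qed

text \<open>Reduces a statement about all priors and optimizers to a pointwise one: every maximum
  point of \<open>g\<close> is a minimum point of \<open>f\<close>. The mass of
  \<open>\<Omega> k g p\<close> concentrates on superlevel sets of \<open>g\<close>, where
  \<open>f\<close> is small.\<close>

lemma catastrophicI:
  fixes f g :: "real ^ 'n \<Rightarrow> real"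
  assumes f: "f \<in> value_functions" and g: "g \<in> value_functions"
    and zero: "\<And>x. x \<in> cube \<Longrightarrow> g x = 1 \<Longrightarrow> f x = 0"
  shows "catastrophic f g"
proof -
  have gm: "g \<in> measurable_functions"
    using g value_functions_subset_measurable_functions by blast
  have fb: "f \<in> borel_measurable borel_cube" and gb: "g \<in> borel_measurable borel_cube"
    using f g by (auto simp: value_functions_def intro: borel_measurable_continuous_on_restrict)
  have "Limsup at_top (\<lambda>k. ereal (\<integral>x. f x \<partial>\<Omega> k g p)) \<le> 0"
    if p: "p \<in> prob_measures" and "optimizer \<Omega>" for p \<Omega>
  proof (rule ereal_le_epsilon2)
    fix e :: real
    assume "e > 0"
    \<comment> \<open>The error \<open>e\<close> is split in two: one half bounds \<open>f\<close>
      on the superlevel set, the other bounds the mass outside it.\<close>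
    then obtain M where M: "M < 1" "\<And>x. x \<in> cube \<Longrightarrow> M < g x \<Longrightarrow> f x < e / 2"
      using value_functions_superlevel[OF f g zero, of "e / 2"] by auto
    let ?A = "{x \<in> cube. g x > M}"
    note opt = bspec[OF bspec[OF \<open>optimizer \<Omega>\<close>[unfolded optimizer_def] gm] p,
        unfolded value_functions_INF_SUP(2)[OF g]]
    from opt have \<Omega>: "\<forall>k\<ge>0. \<Omega> k g p \<in> prob_measures"
      by (elim conjE)
    from opt have "\<forall>M<1. ((\<lambda>k. measure (\<Omega> k g p) {x \<in> cube. g x > M}) \<longlongrightarrow> 1) at_top"
      by (elim conjE)
    then have "((\<lambda>k. measure (\<Omega> k g p) ?A) \<longlongrightarrow> 1) at_top"
      using M(1) by blast
    then have "\<forall>\<^sub>F k in at_top. 1 - e / 2 < measure (\<Omega> k g p) ?A"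
      by (rule order_tendstoD(1)) (use \<open>e > 0\<close> in simp)
    \<comment> \<open>Restricting to nonnegative \<open>k\<close> matters: only there is
      \<open>\<Omega> k g p\<close> known to be a probability measure.\<close>
    then have "\<forall>\<^sub>F k in at_top. ereal (\<integral>x. f x \<partial>\<Omega> k g p) \<le> ereal e"
      using eventually_ge_at_top[of 0]
    proof eventually_elim
      case (elim k)
      define Q where "Q = \<Omega> k g p"
      have Q: "prob_space Q" "sets Q = sets borel_cube"
        using \<Omega> elim(2) by (auto simp: Q_def prob_measures_def space_prob_algebra)
      interpret Q: prob_space Q by fact
      have sp: "space Q = cube"
        using sets_eq_imp_space_eq[OF Q(2)] by (simp add: space_restrict_space)
      have fQ [measurable]: "f \<in> borel_measurable Q" and gQ [measurable]: "g \<in> borel_measurable Q"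
        using fb gb measurable_cong_sets[OF Q(2) refl] by blast+
      have "{x \<in> space Q. g x > M} \<in> sets Q"
        by measurable
      then have A: "?A \<in> sets Q"
        by (simp add: sp)
      then have int_A: "integrable Q (indicator ?A :: _ \<Rightarrow> real)"
        by (intro integrable_real_indicator) (simp_all add: Q.emeasure_eq_measure)
      \<comment> \<open>On \<open>?A\<close> the first summand alone bounds \<open>f\<close>; off
        \<open>?A\<close> the second summand is 1, which bounds \<open>f\<close> trivially.\<close>
      have "(\<integral>x. f x \<partial>Q) \<le> (\<integral>x. e / 2 + (1 - indicator ?A x) \<partial>Q)"
      proof (rule integral_mono)
        show "integrable Q f"
          by (rule Q.integrable_const_bound[where B = 1])
            (use value_functions_bounds[OF f] sp in \<open>auto intro!: AE_I2\<close>)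
        show "integrable Q (\<lambda>x. e / 2 + (1 - indicator ?A x))"
          using int_A by (intro Bochner_Integration.integrable_add
              Bochner_Integration.integrable_diff Q.integrable_const)
        show "f x \<le> e / 2 + (1 - indicator ?A x)" if "x \<in> space Q" for x
          using that M(2)[of x] value_functions_bounds[OF f, of x] \<open>e > 0\<close>
          by (auto simp: sp indicator_def)
      qed
      also have "\<dots> = e / 2 + (1 - measure Q ?A)"
        using int_A A sets.sets_into_space[OF A]
        by (simp add: Q.prob_space Int_absorb2)
      also have "\<dots> \<le> e"
        using elim(1) by (simp add: Q_def)
      finally show ?case by (simp add: Q_def)
    qed
    then show "Limsup at_top (\<lambda>k. ereal (\<integral>x. f x \<partial>\<Omega> k g p)) \<le> 0 + ereal e"
      by (simp add: Limsup_bounded)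
  qed
  then show ?thesis
    by (simp add: catastrophic_def eta_catastrophic_def value_functions_INF_SUP[OF f]
        zero_ereal_def)
qed

lemma borel_measurable_prob_density:
  fixes p :: "real ^ 'n \<Rightarrow> real"
  assumes "prob_density p"
  shows "(\<lambda>x. ennreal (p x)) \<in> borel_measurable (restrict_space lborel cube)"
proof -
  have "sets (restrict_space lborel cube) = sets (borel_cube :: (real ^ 'n) measure)"
    by (intro sets_restrict_space_cong) simp
  from measurable_cong_sets[OF this refl] have "p \<in> borel_measurable (restrict_space lborel cube)"
    using assms by (auto simp: prob_density_def)
  then show ?thesis by measurable
qed

lemma prob_space_sampling_measure:
  fixes p :: "real ^ 'n \<Rightarrow> real"
  assumes "prob_density p"
  shows "prob_space (sampling_measure p)"
proof
  let ?L = "restrict_space lborel cube :: (real ^ 'n) measure"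
  have "emeasure (sampling_measure p) (space (sampling_measure p)) =
      (\<integral>\<^sup>+x. ennreal (p x) * indicator (space ?L) x \<partial>?L)"
    unfolding sampling_measure_def space_density
    by (intro emeasure_density borel_measurable_prob_density assms sets.top)
  also have "\<dots> = (\<integral>\<^sup>+x. ennreal (p x) \<partial>?L)"
    by (intro nn_integral_cong) simp
  also have "\<dots> = 1"
    using assms by (simp add: prob_density_def)
  finally show "emeasure (sampling_measure p) (space (sampling_measure p)) = 1" .
qed

lemma sets_sampling_measure_Int:
  "B \<in> sets borel \<Longrightarrow> cube \<inter> B \<in> sets (sampling_measure p)"
  by (auto simp: sampling_measure_def sets_restrict_space)

text \<open>The balls shrink to a single point, which is Lebesgue null and hence null for any
  measure with a density; continuity from above of a finite measure gives the limit.\<close>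

lemma sampling_measure_cball_tendsto_0:
  fixes p :: "real ^ 'n \<Rightarrow> real"
  assumes p: "prob_density p"
  shows "(\<lambda>i. measure (sampling_measure p) (cube \<inter> cball z (inverse (Suc i)))) \<longlonglongrightarrow> 0"
proof -
  let ?L = "restrict_space lborel cube :: (real ^ 'n) measure"
  let ?S = "sampling_measure p"
  interpret S: prob_space ?S
    by (rule prob_space_sampling_measure[OF p])
  have "(\<Inter>i. cube \<inter> cball z (inverse (real (Suc i)))) \<subseteq> cube \<inter> {z}"
  proof
    fix x
    assume x: "x \<in> (\<Inter>i. cube \<inter> cball z (inverse (real (Suc i))))"
    have "dist z x \<le> 0"
      by (rule LIMSEQ_le_const[OF LIMSEQ_inverse_real_of_nat]) (use x in auto)
    with x show "x \<in> cube \<inter> {z}" by auto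
  qed
  then have "measure ?S (\<Inter>i. cube \<inter> cball z (inverse (real (Suc i)))) \<le> measure ?S (cube \<inter> {z})"
    by (intro S.finite_measure_mono sets_sampling_measure_Int) auto
  also have "cube \<inter> {z} \<in> null_sets lborel"
    by (rule null_sets_subset[of "{z}"]) auto
  then have "cube \<inter> {z} \<in> null_sets ?L"
    by (simp add: null_sets_restrict_space)
  then have "cube \<inter> {z} \<in> null_sets ?S"
    using absolutely_continuousI_density[OF borel_measurable_prob_density[OF p]]
    by (auto simp: sampling_measure_def absolutely_continuous_def)
  then have "measure ?S (cube \<inter> {z}) = 0"
    by (simp add: measure_eq_0_null_sets)
  finally have "measure ?S (\<Inter>i. cube \<inter> cball z (inverse (real (Suc i)))) = 0"
    by (simp add: measure_le_0_iff)
  moreover have "decseq (\<lambda>i. cube \<inter> cball z (inverse (real (Suc i))))"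
    by (intro decseq_SucI Int_mono subset_refl subset_cball le_imp_inverse_le) auto
  then have "(\<lambda>i. measure ?S (cube \<inter> cball z (inverse (real (Suc i)))))
      \<longlonglongrightarrow> measure ?S (\<Inter>i. cube \<inter> cball z (inverse (real (Suc i))))"
    by (intro S.finite_Lim_measure_decseq) (auto intro!: sets_sampling_measure_Int)
  ultimately show ?thesis by simp
qed

theorem theorem5p1:
  fixes p\<^sub>S :: "real ^ 'n \<Rightarrow> real" and f :: "real ^ 'n \<Rightarrow> real" and \<alpha> \<beta> :: real
  assumes "prob_density p\<^sub>S"
    and "f \<in> value_functions"
    and "0 < \<alpha>" "\<alpha> < 1" "0 < \<beta>" "\<beta> < 1"
  shows "\<exists>g \<in> value_functions. C_proxy p\<^sub>S \<alpha> \<beta> f g \<and> catastrophic f g"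
proof -
  note f = assms(2)
  let ?S = "sampling_measure p\<^sub>S"
  interpret S: prob_space ?S
    by (rule prob_space_sampling_measure[OF assms(1)])
  have cf: "continuous_on cube f" and "f ` cube = {0..1}"
    using f by (auto simp: value_functions_def)
  then have "0 \<in> f ` cube" "1 \<in> f ` cube" by auto
  then obtain z w where z: "z \<in> cube" "f z = 0" and w: "w \<in> cube" "f w = 1"
    by (metis imageE)
  then have "dist z w > 0" by auto
  let ?B = "\<lambda>r. cube \<inter> cball z r \<union> cube \<inter> cball w r"
  \<comment> \<open>One radius serves both balls, which may overlap. The bound by
    \<open>dist z w\<close> makes the tent around \<open>z\<close> vanish at \<open>w\<close>, so
    that \<open>h w = 0\<close>.\<close>
  have "\<exists>r>0. r \<le> dist z w \<and> measure ?S (?B r) < \<beta>"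
  proof -
    let ?m = "\<lambda>v i. measure ?S (cube \<inter> cball v (inverse (real (Suc i))))"
    have "(\<lambda>i. ?m z i + ?m w i) \<longlonglongrightarrow> 0 + 0"
      by (intro tendsto_add sampling_measure_cball_tendsto_0 assms(1))
    then have "\<forall>\<^sub>F i in sequentially. ?m z i + ?m w i < \<beta>"
      using \<open>0 < \<beta>\<close> by (auto intro: order_tendstoD)
    moreover have "\<forall>\<^sub>F i in sequentially. inverse (real (Suc i)) < dist z w"
      using LIMSEQ_inverse_real_of_nat \<open>dist z w > 0\<close> by (rule order_tendstoD)
    ultimately have "\<forall>\<^sub>F i in sequentially.
        ?m z i + ?m w i < \<beta> \<and> inverse (real (Suc i)) < dist z w"
      by (rule eventually_conj)
    then obtain i where i: "?m z i + ?m w i < \<beta>" "inverse (real (Suc i)) < dist z w"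
      by (auto dest: eventually_happens)
    have "measure ?S (?B (inverse (real (Suc i)))) \<le> ?m z i + ?m w i"
      by (intro measure_Un_le sets_sampling_measure_Int) auto
    with i show ?thesis
      by (intro exI[of _ "inverse (real (Suc i))"]) auto
  qed
  then obtain r where r: "r > 0" "r \<le> dist z w" "measure ?S (?B r) < \<beta>" by blast
  \<comment> \<open>The first argument of \<open>max\<close> is the tent at \<open>z\<close>. The
    factor \<open>min 1 (dist w x / r)\<close> is 0 at \<open>w\<close> and 1 outside the ball
    around \<open>w\<close>. Taking the maximum instead of a sum keeps the values at most 1.\<close>
  define h where
    "h x = max (1 - dist z x / r) (min (f x) (1 - \<alpha>) * min 1 (dist w x / r))" for x
  define g where "g = restrict h cube"
  have ch: "continuous_on cube h"
    unfolding h_def using r(1) by (intro continuous_intros cf) auto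
  have prod: "0 \<le> min (f x) (1 - \<alpha>) * min 1 (dist w x / r)"
    "min (f x) (1 - \<alpha>) * min 1 (dist w x / r) \<le> 1 - \<alpha>" if "x \<in> cube" for x
  proof -
    have "0 \<le> min (f x) (1 - \<alpha>)" "0 \<le> min 1 (dist w x / r)"
      using value_functions_bounds[OF f that] \<open>\<alpha> < 1\<close> r(1) by auto
    then show "0 \<le> min (f x) (1 - \<alpha>) * min 1 (dist w x / r)"
      "min (f x) (1 - \<alpha>) * min 1 (dist w x / r) \<le> 1 - \<alpha>"
      using mult_mono[of "min (f x) (1 - \<alpha>)" "1 - \<alpha>" "min 1 (dist w x / r)" 1] \<open>\<alpha> < 1\<close>
      by auto
  qed
  \<comment> \<open>The product stays at or below \<open>1 - \<alpha>\<close>, so the value 1 can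
    come only from the tent, which reaches it only at its apex \<open>z\<close>.\<close>
  have h_bounds: "0 \<le> h x" "h x \<le> 1" and h_eq_1: "h x = 1 \<Longrightarrow> x = z" if "x \<in> cube" for x
    using prod[OF that] \<open>0 < \<alpha>\<close> r(1)
    by (auto simp: h_def le_max_iff_disj) (auto simp: max_def split: if_splits)
  have "h z = 1" "h w = 0"
    using prod[OF z(1)] \<open>0 < \<alpha>\<close> r by (auto simp: h_def max_def field_simps)
  \<comment> \<open>Intermediate values: the image of the connected cube is connected and contains 0
    and 1.\<close>
  then have "{0..1} \<subseteq> h ` cube"
    using connected_continuous_image[OF ch convex_connected[OF convex_box(1)]] z(1) w(1)
    by (intro connected_contains_Icc) (auto intro: rev_image_eqI)
  then have "h ` cube = {0..1}"
    using h_bounds by auto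
  then have g: "g \<in> value_functions"
    using ch by (auto simp: value_functions_def g_def cong: continuous_on_cong image_cong)
  have "{x \<in> cube. \<bar>g x - f x\<bar> > \<alpha>} \<subseteq> ?B r"
  proof (rule subsetI, rule ccontr)
    fix x
    assume x: "x \<in> {x \<in> cube. \<bar>g x - f x\<bar> > \<alpha>}" and "x \<notin> ?B r"
    \<comment> \<open>Outside both balls the tent is negative and the factor at \<open>w\<close>
      equals 1, so only the cutoff of \<open>f\<close> remains; as \<open>f x \<le> 1\<close>, it
      moves \<open>f\<close> by at most \<alpha>.\<close>
    then have "1 < dist z x / r" "1 < dist w x / r"
      using r(1) by auto
    then have "g x = min (f x) (1 - \<alpha>)"
      using x prod[of x] by (auto simp: g_def h_def)
    with x value_functions_bounds[OF f, of x] \<open>0 < \<alpha>\<close> show False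
      by (auto simp: min_def split: if_splits)
  qed
  then have "measure ?S {x \<in> cube. \<bar>g x - f x\<bar> > \<alpha>} \<le> measure ?S (?B r)"
    by (intro S.finite_measure_mono sets.Un sets_sampling_measure_Int) auto
  then have "C_proxy p\<^sub>S \<alpha> \<beta> f g"
    using f g r(3) by (simp add: C_proxy_def)
  moreover have "catastrophic f g"
    by (rule catastrophicI[OF f g]) (use h_eq_1 z(2) in \<open>auto simp: g_def\<close>)
  ultimately show ?thesis using g by blast
qed

end
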